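(* Let $x_{i,j}$, $1\le i,j\le d$, be coordinates on the space of $d\times d$ matrices over $\Bbbk$. For each $i$, let $\rho_i = x_{i,1}+\dots+x_{i,d}$ be the $i$th row-sum. Let $I$ be the ideal of $\Bbbk[x_{i,j}]$ generated by the quadrics $x_{i,j_1}x_{i,j_2}$ for all $i$ and all $j_1\ne j_2$, the quadrics $x_{i_1,j}x_{i_2,j}$ for all $j$ and all $i_1\neq i_2$, and the quadrics $\rho_i^2-\rho_{i-1}\rho_{i+1}$ for all $i \in\{1,\dots,d\}$, with the indices of $\rho$ considered modulo $d$. Then the common zero locus of these equations in the projective space of nonzero $d\times d$ matrices over $\Bbbk$ up to scalar is exactly the set of projective points $\{[D^jP_\sigma] : 1\le j\le d,\ \sigma\in S_d\}$.
   Context: Let $d\ge 1$ be an integer, $\Bbbk$ a field in which $d!$ is invertible, and $\omega\in\Bbbk$ a primitive $d$th root of unity. $S_d$ is the symmetric group on $\{1,\dots,d\}$ and $\sigma i$ is $\sigma$ applied to $i$. Let $E_{i,j}$ be the $d\times d$ matrix with $1$ in position $(i,j)$ and $0$ elsewhere, $P_\sigma=\sum_{i=1}^d E_{i,\sigma i}$ for $\sigma\in S_d$, and $D=\operatorname{diag}(\omega,\omega^2,\dots,\omega^d)$. For a nonzero matrix $A$, $[A]$ denotes its class up to nonzero scalar multiple, a point of the projective space $\mathbb{P}^{d^2-1}(\Bbbk)$. *)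

theory Defs
  imports
    "HOL-Library.Poly_Mapping"
    "HOL-Combinatorics.Permutations"
    "HOL-Algebra.Ideal"
    "Jordan_Normal_Form.Matrix"
begin

definition primitive_root_of_unity :: "nat \<Rightarrow> 'a :: field \<Rightarrow> bool" where
  "primitive_root_of_unity d w \<longleftrightarrow> d > 0 \<and> w ^ d = 1 \<and> (\<forall>k. 0 < k \<and> k < d \<longrightarrow> w ^ k \<noteq> 1)"


section \<open>Matrices and projective points\<close>

text \<open>
  Library matrices are indexed from 0, whereas all indices below range over \<open>{1..d}\<close>;
  position \<open>(i, j)\<close> is therefore the library entry \<open>(i - 1, j - 1)\<close>.
\<close>

definition unit_matrix :: "nat \<Rightarrow> nat \<Rightarrow> nat \<Rightarrow> 'a :: field mat" where
  "unit_matrix d i j = Matrix.mat d d (\<lambda>(r, c). if r + 1 = i \<and> c + 1 = j then 1 else 0)"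

text \<open>The sum of the matrices \<open>unit_matrix d i (\<sigma> i)\<close>, taken entry by entry because matrices
  of unspecified size do not form an additive monoid.\<close>

definition perm_matrix :: "nat \<Rightarrow> (nat \<Rightarrow> nat) \<Rightarrow> 'a :: field mat" where
  "perm_matrix d \<sigma> = Matrix.mat d d (\<lambda>rc. \<Sum>i = 1..d. unit_matrix d i (\<sigma> i) $$ rc)"

definition root_diag :: "nat \<Rightarrow> 'a :: field \<Rightarrow> 'a mat" where
  "root_diag d w = mat_diag d (\<lambda>r. w ^ (r + 1))"

definition proj_class :: "'a :: field mat \<Rightarrow> 'a mat set" where
  "proj_class A = {c \<cdot>\<^sub>m A | c. c \<noteq> 0}"

definition proj_space :: "nat \<Rightarrow> 'a :: field mat set set" where
  "proj_space d = proj_class ` (carrier_mat d d - {0\<^sub>m d d})"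


section \<open>Polynomials in the matrix coordinates\<close>

text \<open>
  A monomial is a finitely supported exponent function on the variables \<open>(i, j)\<close>, and a
  polynomial is a finitely supported coefficient function on the monomials; the
  multiplication of this type is convolution. The type has variables for
  all pairs of naturals; \<open>coord_ring d\<close> is the polynomial ring on those with
  \<open>1 \<le> i, j \<le> d\<close>.
\<close>

type_synonym 'a coord_poly = "(nat \<times> nat \<Rightarrow>\<^sub>0 nat) \<Rightarrow>\<^sub>0 'a"

definition coord_ring :: "nat \<Rightarrow> 'a :: field coord_poly ring" where
  "coord_ring d =
    \<lparr>carrier = {p. \<forall>m \<in> Poly_Mapping.keys p. Poly_Mapping.keys m \<subseteq> {1..d} \<times> {1..d}},
     monoid.mult = (*), one = 1, zero = 0, add = (+)\<rparr>"

text \<open>Guarantees that \<^const>\<open>genideal\<close> over \<^const>\<open>coord_ring\<close> is not degenerate.\<close>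

lemma cring_coord_ring: "cring (coord_ring d :: 'a :: field coord_poly ring)"
proof (rule cringI)
  let ?R = "coord_ring d :: 'a coord_poly ring"
  have add_closed: "x + y \<in> carrier ?R" if "x \<in> carrier ?R" "y \<in> carrier ?R" for x y
    using that keys_add[of x y] unfolding coord_ring_def by auto
  have mult_closed: "x * y \<in> carrier ?R" if x: "x \<in> carrier ?R" and y: "y \<in> carrier ?R" for x y
  proof -
    have "Poly_Mapping.keys m \<subseteq> {1..d} \<times> {1..d}" if m: "m \<in> Poly_Mapping.keys (x * y)" for m
    proof -
      obtain a b where "m = a + b" "a \<in> Poly_Mapping.keys x" "b \<in> Poly_Mapping.keys y"
        using m keys_mult[of x y] by blast
      then show ?thesis
        using x y keys_add[of a b] unfolding coord_ring_def by fastforce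
    qed
    then show ?thesis by (simp add: coord_ring_def)
  qed
  have uminus_closed: "- x \<in> carrier ?R" if "x \<in> carrier ?R" for x
    using that by (simp add: coord_ring_def)
  have zero_one: "0 \<in> carrier ?R" "1 \<in> carrier ?R"
    by (simp_all add: coord_ring_def)
  have ops: "add ?R = (+)" "monoid.mult ?R = (*)" "zero ?R = 0" "one ?R = 1"
    by (simp_all add: coord_ring_def)
  show "abelian_group ?R"
  proof (rule abelian_groupI, unfold ops)
    show "\<exists>y\<in>carrier ?R. y + x = 0" if "x \<in> carrier ?R" for x
      using uminus_closed[OF that] by (intro bexI[of _ "- x"]) simp_all
  qed (simp_all only: add_closed zero_one ac_simps add_0_left add_0_right)
  show "Group.comm_monoid ?R"
    by (rule comm_monoidI, unfold ops) (simp_all only: mult_closed zero_one ac_simps mult_1_left mult_1_right)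
  show "(x \<oplus>\<^bsub>?R\<^esub> y) \<otimes>\<^bsub>?R\<^esub> z = x \<otimes>\<^bsub>?R\<^esub> z \<oplus>\<^bsub>?R\<^esub> y \<otimes>\<^bsub>?R\<^esub> z" for x y z
    unfolding ops by (rule distrib_right)
qed

definition coord :: "nat \<Rightarrow> nat \<Rightarrow> 'a :: field coord_poly" where
  "coord i j = Poly_Mapping.single (Poly_Mapping.single (i, j) 1) 1"

definition eval_coord :: "'a :: field coord_poly \<Rightarrow> 'a mat \<Rightarrow> 'a" where
  "eval_coord p A =
    (\<Sum>m \<in> Poly_Mapping.keys p. Poly_Mapping.lookup p m *
      (\<Prod>(i, j) \<in> Poly_Mapping.keys m. A $$ (i - 1, j - 1) ^ Poly_Mapping.lookup m (i, j)))"

text \<open>The polynomial is required to vanish at every representative of the point, so that the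
  definition makes sense for non-homogeneous elements as well.\<close>

definition proj_zero_locus :: "nat \<Rightarrow> 'a :: field coord_poly set \<Rightarrow> 'a mat set set" where
  "proj_zero_locus d F = {p \<in> proj_space d. \<forall>A \<in> p. \<forall>f \<in> F. eval_coord f A = 0}"


section \<open>The quadrics\<close>

text \<open>The row index is an integer that is reduced modulo \<open>d\<close> to its representative
  in \<open>{1..d}\<close>.\<close>

definition row_sum :: "nat \<Rightarrow> int \<Rightarrow> 'a :: field coord_poly" where
  "row_sum d i = (\<Sum>j = 1..d. coord (nat ((i - 1) mod int d) + 1) j)"

definition quadrics :: "nat \<Rightarrow> 'a :: field coord_poly set" where
  "quadrics d =
    {coord i j1 * coord i j2 | i j1 j2.
       i \<in> {1..d} \<and> j1 \<in> {1..d} \<and> j2 \<in> {1..d} \<and> j1 \<noteq> j2} \<union>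
    {coord i1 j * coord i2 j | i1 i2 j.
       i1 \<in> {1..d} \<and> i2 \<in> {1..d} \<and> j \<in> {1..d} \<and> i1 \<noteq> i2} \<union>
    {(row_sum d i)\<^sup>2 - row_sum d (i - 1) * row_sum d (i + 1) | i. i \<in> {1..int d}}"

definition quadric_ideal :: "nat \<Rightarrow> 'a :: field coord_poly set" where
  "quadric_ideal d = genideal (coord_ring d) (quadrics d)"

end

theory Submission
  imports Defs "HOL-Computational_Algebra.Polynomial"
begin

text \<open>
  The monomial quadrics say that each row and each column of \<open>A\<close> has at most one nonzero entry,
  so a row sum vanishes only if its row does. If one row sum were zero, the cyclic relations
  \<open>\<rho>\<^sub>i\<^sup>2 = \<rho>\<^sub>i\<^sub>-\<^sub>1 \<rho>\<^sub>i\<^sub>+\<^sub>1\<close> would propagate this to all of them and \<open>A = 0\<close>. Hence the support of \<open>A\<close> is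
  the graph of a permutation and the row sums form a cyclic geometric progression, whose ratio is
  a \<open>d\<close>th root of unity, that is, a power of \<open>\<omega>\<close>.
\<close>

section \<open>Evaluation at a matrix is a ring homomorphism\<close>

definition eval_monom :: "'a :: field mat \<Rightarrow> (nat \<times> nat \<Rightarrow>\<^sub>0 nat) \<Rightarrow> 'a" where
  "eval_monom A m = (\<Prod>(i, j) \<in> Poly_Mapping.keys m. A $$ (i - 1, j - 1) ^ Poly_Mapping.lookup m (i, j))"

text \<open>Additional variables have exponent 0 and contribute factors \<open>x ^ 0 = 1\<close>,
  even where the entry is zero. Distinct monomials can thus be multiplied over a common index
  set.\<close>

lemma eval_monom_superset:
  assumes "finite K" "Poly_Mapping.keys m \<subseteq> K"
  shows "eval_monom A m = (\<Prod>(i, j) \<in> K. A $$ (i - 1, j - 1) ^ Poly_Mapping.lookup m (i, j))"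
  unfolding eval_monom_def
  by (rule prod.mono_neutral_left) (use assms in \<open>auto simp: in_keys_iff\<close>)

lemma eval_monom_add: "eval_monom A (m + n) = eval_monom A m * eval_monom A n"
proof -
  let ?K = "Poly_Mapping.keys m \<union> Poly_Mapping.keys n"
  have "Poly_Mapping.keys (m + n) \<subseteq> ?K" by (rule keys_add)
  then show ?thesis
    by (simp add: eval_monom_superset[of ?K] lookup_add power_add case_prod_unfold
        flip: prod.distrib)
qed

lemma eval_coord_alt:
  "eval_coord p A = (\<Sum>m \<in> Poly_Mapping.keys p. Poly_Mapping.lookup p m * eval_monom A m)"
  by (simp add: eval_coord_def eval_monom_def)

lemma eval_coord_superset:
  assumes "finite K" "Poly_Mapping.keys p \<subseteq> K"
  shows "eval_coord p A = (\<Sum>m \<in> K. Poly_Mapping.lookup p m * eval_monom A m)"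
  unfolding eval_coord_alt
  by (rule sum.mono_neutral_left) (use assms in \<open>auto simp: in_keys_iff\<close>)

lemma eval_coord_zero [simp]: "eval_coord 0 A = 0"
  by (simp add: eval_coord_def)

lemma eval_coord_add: "eval_coord (p + q) A = eval_coord p A + eval_coord q A"
proof -
  let ?K = "Poly_Mapping.keys p \<union> Poly_Mapping.keys q"
  have "Poly_Mapping.keys (p + q) \<subseteq> ?K" by (rule keys_add)
  then show ?thesis
    by (simp add: eval_coord_superset[of ?K] lookup_add distrib_right flip: sum.distrib)
qed

lemma eval_coord_uminus: "eval_coord (- p) A = - eval_coord p A"
  using eval_coord_add[of p "- p" A] by (simp add: eq_neg_iff_add_eq_0 add.commute)

lemma eval_coord_diff: "eval_coord (p - q) A = eval_coord p A - eval_coord q A"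
  using eval_coord_add[of p "- q" A] by (simp add: eval_coord_uminus)

lemma eval_coord_sum: "eval_coord (\<Sum>x \<in> X. f x) A = (\<Sum>x \<in> X. eval_coord (f x) A)"
  by (induction X rule: infinite_finite_induct) (simp_all add: eval_coord_add)

lemma eval_coord_single: "eval_coord (Poly_Mapping.single m a) A = a * eval_monom A m"
  by (cases "a = 0") (simp_all add: eval_coord_alt)

text \<open>The rule \<open>update_induct\<close> inserts one fresh key at a time. Reading that as
  adding a single term makes additivity of evaluation applicable in the inductions for
  products.\<close>

lemma update_eq_single_add:
  assumes "a \<notin> Poly_Mapping.keys f"
  shows "Poly_Mapping.update a b f = Poly_Mapping.single a b + f"
  using assms
  by (intro poly_mapping_eqI) (auto simp: lookup_update lookup_add lookup_single in_keys_iff when_def)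

lemma eval_coord_single_mult:
  "eval_coord (Poly_Mapping.single m a * q) A = a * eval_monom A m * eval_coord q A"
  by (induction q rule: update_induct)
    (simp_all add: update_eq_single_add distrib_left mult_single eval_coord_add eval_coord_single
      eval_monom_add)

lemma eval_coord_mult: "eval_coord (p * q) A = eval_coord p A * eval_coord q A"
  by (induction p rule: update_induct)
    (simp_all add: update_eq_single_add distrib_right eval_coord_add eval_coord_single
      eval_coord_single_mult)

lemma eval_coord_power2: "eval_coord (p\<^sup>2) A = (eval_coord p A)\<^sup>2"
  by (simp add: power2_eq_square eval_coord_mult)

lemma eval_coord_coord [simp]: "eval_coord (coord i j) A = A $$ (i - 1, j - 1)"
  by (simp add: coord_def eval_coord_single eval_monom_def)

section \<open>Zero loci of generated ideals\<close>

lemma carrier_coord_ring: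
  "p \<in> carrier (coord_ring d) \<longleftrightarrow>
    (\<forall>m \<in> Poly_Mapping.keys p. Poly_Mapping.keys m \<subseteq> {1..d} \<times> {1..d})"
  by (simp add: coord_ring_def)

text \<open>This is the kernel of evaluation at \<open>A\<close> on \<open>coord_ring d\<close>; it
  is the ideal to which minimality of \<open>genideal\<close> will be applied.\<close>

lemma vanishing_ideal:
  fixes A :: "'a :: field mat"
  shows "ideal {p \<in> carrier (coord_ring d). eval_coord p A = 0} (coord_ring d)"
proof -
  let ?R = "coord_ring d :: 'a coord_poly ring"
  let ?I = "{p \<in> carrier ?R. eval_coord p A = 0}"
  interpret cring ?R by (rule cring_coord_ring)
  have ops: "add ?R = ((+) :: 'a coord_poly \<Rightarrow> _)"
    "monoid.mult ?R = ((*) :: 'a coord_poly \<Rightarrow> _)"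
    "zero ?R = (0 :: 'a coord_poly)"
    by (simp_all add: coord_ring_def)
  show ?thesis
  proof (rule idealI)
    show "subgroup ?I (add_monoid ?R)"
    proof (rule add.subgroupI)
      fix p assume p: "p \<in> ?I"
      \<comment> \<open>The inverse in the record is given abstractly; the inverse law identifies it
        with the polynomial \<open>- p\<close>.\<close>
      then have "\<ominus>\<^bsub>?R\<^esub> p \<oplus>\<^bsub>?R\<^esub> p = \<zero>\<^bsub>?R\<^esub>"
        by (intro l_neg) auto
      then have "\<ominus>\<^bsub>?R\<^esub> p = - p"
        unfolding ops by (simp add: eq_neg_iff_add_eq_0)
      then show "\<ominus>\<^bsub>?R\<^esub> p \<in> ?I"
        using p a_inv_closed[of p] by (auto simp: eval_coord_uminus)
    next
      have "\<zero>\<^bsub>?R\<^esub> \<in> ?I"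
        using zero_closed by (simp add: ops)
      then show "?I \<noteq> {}" by blast
    next
      fix p q
      assume "p \<in> ?I"
        and "q \<in> ?I"
      then show "p \<oplus>\<^bsub>?R\<^esub> q \<in> ?I"
        using a_closed[of p q] by (simp add: ops eval_coord_add)
    qed auto
  next
    fix p q
    assume "p \<in> ?I" "q \<in> carrier ?R"
    then show "q \<otimes>\<^bsub>?R\<^esub> p \<in> ?I"
      and "p \<otimes>\<^bsub>?R\<^esub> q \<in> ?I"
      using m_closed[of p q] m_closed[of q p] by (simp_all add: ops eval_coord_mult)
  qed (rule ring_axioms)
qed

text \<open>The generators lie in the ideal, which gives one inclusion. Conversely, if
  \<open>F\<close> vanishes at \<open>A\<close>, the vanishing ideal of \<open>A\<close> contains
  \<open>F\<close> and so, by minimality, the generated ideal.\<close>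

lemma proj_zero_locus_genideal:
  fixes F :: "'a :: field coord_poly set"
  assumes "F \<subseteq> carrier (coord_ring d)"
  shows "proj_zero_locus d (genideal (coord_ring d) F) = proj_zero_locus d F"
proof -
  interpret cring "coord_ring d :: 'a coord_poly ring" by (rule cring_coord_ring)
  have "(\<forall>f \<in> genideal (coord_ring d) F. eval_coord f A = 0) \<longleftrightarrow> (\<forall>f \<in> F. eval_coord f A = 0)" for A
    using genideal_self[OF assms] genideal_minimal[OF vanishing_ideal[of d A], of F] assms by blast
  then show ?thesis by (simp add: proj_zero_locus_def)
qed

lemma quadrics_carrier:
  assumes "d \<ge> 1"
  shows "(quadrics d :: 'a :: field coord_poly set) \<subseteq> carrier (coord_ring d)"
proof -
  interpret cring "coord_ring d :: 'a coord_poly ring" by (rule cring_coord_ring)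
  have coord: "(coord i j :: 'a coord_poly) \<in> carrier (coord_ring d)"
    if "i \<in> {1..d}" "j \<in> {1..d}" for i j
    using that by (simp add: carrier_coord_ring coord_def)
  have mult: "p * q \<in> carrier (coord_ring d)"
    if "p \<in> carrier (coord_ring d)" "q \<in> carrier (coord_ring d)" for p q :: "'a coord_poly"
    using m_closed[OF that] by (simp add: coord_ring_def)
  have diff: "p - q \<in> carrier (coord_ring d)"
    if "p \<in> carrier (coord_ring d)" "q \<in> carrier (coord_ring d)" for p q :: "'a coord_poly"
    using that keys_diff[of p q] unfolding carrier_coord_ring by blast
  have sum: "sum f X \<in> carrier (coord_ring d)"
    if "\<And>x. x \<in> X \<Longrightarrow> f x \<in> carrier (coord_ring d)" for X and f :: "nat \<Rightarrow> 'a coord_poly"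
    using that keys_sum[of f X] unfolding carrier_coord_ring by blast
  have "nat ((i - 1) mod int d) < d" for i
    using assms by (simp add: nat_less_iff)
  then have row: "row_sum d i \<in> carrier (coord_ring d :: 'a coord_poly ring)" for i
    unfolding row_sum_def by (intro sum coord) (auto simp: Suc_le_eq)
  show ?thesis
    unfolding quadrics_def power2_eq_square by (auto intro!: mult diff coord row)
qed

section \<open>The quadrics in terms of matrix entries\<close>

lemma eval_row_sum:
  "eval_coord (row_sum d (int k + 1)) A = (\<Sum>j<d. A $$ (k mod d, j))"
proof -
  have "eval_coord (row_sum d (int k + 1)) A = (\<Sum>j = 1..d. A $$ (k mod d, j - 1))"
    by (simp add: row_sum_def eval_coord_sum flip: zmod_int)
  also have "\<dots> = (\<Sum>j<d. A $$ (k mod d, j))"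
    by (rule sum.reindex_bij_witness[of _ Suc "\<lambda>j. j - 1"]) auto
  finally show ?thesis .
qed

lemma row_sum_mod: "row_sum d (i + int d) = row_sum d i"
proof -
  have "(i + int d - 1) mod int d = (i - 1) mod int d"
    by (metis add_diff_eq add.commute diff_add_eq mod_add_self2)
  then show ?thesis by (simp add: row_sum_def)
qed

text \<open>The row sum relation is stated for every natural \<open>k\<close>, not for one period
  only, so that later inductions never wrap around. Both forms agree because \<open>row_sum\<close>
  has period \<open>d\<close> in its index.\<close>

lemma quadrics_vanish_iff:
  assumes "d \<ge> 1"
  shows "(\<forall>f \<in> quadrics d. eval_coord f A = 0) \<longleftrightarrow>
    (\<forall>i<d. \<forall>j1<d. \<forall>j2<d. j1 \<noteq> j2 \<longrightarrow> A $$ (i, j1) * A $$ (i, j2) = 0) \<and>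
    (\<forall>i1<d. \<forall>i2<d. \<forall>j<d. i1 \<noteq> i2 \<longrightarrow> A $$ (i1, j) * A $$ (i2, j) = 0) \<and>
    (\<forall>k. (\<Sum>j<d. A $$ (Suc k mod d, j))\<^sup>2 =
      (\<Sum>j<d. A $$ (k mod d, j)) * (\<Sum>j<d. A $$ (Suc (Suc k) mod d, j)))"
    (is "_ \<longleftrightarrow> ?rows \<and> ?cols \<and> ?geom")
proof -
  let ?R = "\<lambda>k. \<Sum>j<d. A $$ (k mod d, j)"
  let ?q = "\<lambda>i. eval_coord ((row_sum d i)\<^sup>2 - row_sum d (i - 1) * row_sum d (i + 1)) A"
  have shift: "(\<forall>i \<in> {1..d}. P i) \<longleftrightarrow> (\<forall>i<d. P (Suc i))" for P :: "nat \<Rightarrow> bool"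
  proof
    assume P: "\<forall>i<d. P (Suc i)"
    show "\<forall>i \<in> {1..d}. P i"
    proof
      fix i assume "i \<in> {1..d}"
      then show "P i" using P[rule_format, of "i - 1"] by (cases i) auto
    qed
  qed auto
  have rows: "(\<forall>i \<in> {1..d}. \<forall>j1 \<in> {1..d}. \<forall>j2 \<in> {1..d}. j1 \<noteq> j2 \<longrightarrow>
      A $$ (i - 1, j1 - 1) * A $$ (i - 1, j2 - 1) = 0) \<longleftrightarrow> ?rows"
    unfolding shift diff_Suc_1 nat.inject ..
  have cols: "(\<forall>i1 \<in> {1..d}. \<forall>i2 \<in> {1..d}. \<forall>j \<in> {1..d}. i1 \<noteq> i2 \<longrightarrow>
      A $$ (i1 - 1, j - 1) * A $$ (i2 - 1, j - 1) = 0) \<longleftrightarrow> ?cols"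
    unfolding shift diff_Suc_1 nat.inject ..
  \<comment> \<open>A row sum of index \<open>int k + 1\<close> reads row \<open>k mod d\<close>, so
    the quadric centred at row \<open>Suc k\<close> has index \<open>int k + 2\<close>.\<close>
  have q_eval: "?q (int k + 2) = (?R (Suc k))\<^sup>2 - ?R k * ?R (Suc (Suc k))" for k
    using eval_row_sum[of d k A] eval_row_sum[of d "Suc k" A] eval_row_sum[of d "Suc (Suc k)" A]
    by (simp add: eval_coord_diff eval_coord_mult eval_coord_power2 algebra_simps)
  have q_period: "?q (i + int d) = ?q i" for i
  proof -
    have "i + int d - 1 = i - 1 + int d" "i + int d + 1 = i + 1 + int d" by simp_all
    then show ?thesis by (simp only: row_sum_mod)
  qed
  have geom: "(\<forall>i \<in> {1..int d}. ?q i = 0) \<longleftrightarrow> ?geom"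
  proof
    assume L: "\<forall>i \<in> {1..int d}. ?q i = 0"
    \<comment> \<open>The assumption covers one period; strong induction subtracts \<open>d\<close>
      until the index lands there.\<close>
    have "?q (int n + 1) = 0" for n
    proof (induction n rule: less_induct)
      case (less n)
      show ?case
      proof (cases "n < d")
        case True
        then show ?thesis by (intro L[rule_format]) simp
      next
        case False
        then have "?q (int (n - d) + 1) = 0" using assms by (intro less.IH) auto
        then show ?thesis
          using q_period[of "int (n - d) + 1"] False by (simp add: of_nat_diff)
      qed
    qed
    from this[of "Suc _"] have "?q (int k + 2) = 0" for k
      by (simp add: algebra_simps)
    then show ?geom unfolding q_eval by simp
  next
    assume R: ?geom
    show "\<forall>i \<in> {1..int d}. ?q i = 0"
    proof
      fix i assume i: "i \<in> {1..int d}"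
      \<comment> \<open>Adding a period makes the index at least 2, as \<open>i\<close> and
        \<open>d\<close> are at least 1, so \<open>nat\<close> does not truncate and
        \<open>q_eval\<close> applies.\<close>
      then have "int (nat (i + int d - 2)) + 2 = i + int d" using assms by auto
      then have "?q (i + int d) = 0"
        using q_eval[of "nat (i + int d - 2)"] R by simp
      then show "?q i = 0" by (simp only: q_period)
    qed
  qed
  have "(\<forall>f \<in> quadrics d. eval_coord f A = 0) \<longleftrightarrow>
    (\<forall>i \<in> {1..d}. \<forall>j1 \<in> {1..d}. \<forall>j2 \<in> {1..d}. j1 \<noteq> j2 \<longrightarrow>
      eval_coord (coord i j1 * coord i j2) A = 0) \<and>
    (\<forall>i1 \<in> {1..d}. \<forall>i2 \<in> {1..d}. \<forall>j \<in> {1..d}. i1 \<noteq> i2 \<longrightarrow>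
      eval_coord (coord i1 j * coord i2 j) A = 0) \<and>
    (\<forall>i \<in> {1..int d}. ?q i = 0)"
    unfolding quadrics_def by blast
  then show ?thesis
    unfolding eval_coord_mult eval_coord_coord rows cols geom[unfolded eval_coord_mult] .
qed

section \<open>Roots of unity\<close>

text \<open>By primitivity the powers with exponents 1 to \<open>d\<close> are distinct roots of X^d
  - 1. That polynomial has at most \<open>d\<close> roots, so there are no others.\<close>

lemma primitive_root_of_unity_powers:
  fixes w :: "'a :: field"
  assumes "primitive_root_of_unity d w" and "q ^ d = 1"
  obtains j where "1 \<le> j" "j \<le> d" "q = w ^ j"
proof -
  from assms have d: "d > 0" and w: "w ^ d = 1" and prim: "\<And>k. 0 < k \<Longrightarrow> k < d \<Longrightarrow> w ^ k \<noteq> 1"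
    by (auto simp: primitive_root_of_unity_def)
  have w0: "w \<noteq> 0" using w d by (auto simp: power_0_left)
  have eq: "j = k" if "w ^ j = w ^ k" "1 \<le> j" "j \<le> k" "k \<le> d" for j k
  proof (rule ccontr)
    assume "j \<noteq> k"
    \<comment> \<open>Cancelling \<open>w ^ j\<close> leaves the exponent \<open>k - j\<close>,
      which is below \<open>d\<close> because \<open>j\<close> is at least 1.\<close>
    moreover have "w ^ k = w ^ j * w ^ (k - j)" using that power_add[of w j "k - j"] by simp
    then have "w ^ (k - j) = 1" using that w0 by simp
    ultimately show False using prim[of "k - j"] that by auto
  qed
  then have inj: "inj_on (\<lambda>j. w ^ j) {1..d}"
    by (intro linorder_inj_onI') (metis eq atLeastAtMost_iff less_imp_le less_irrefl)
  let ?p = "Polynomial.monom 1 d - 1 :: 'a poly"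
  have coeff: "poly.coeff ?p d = 1" using d by simp
  then have p0: "?p \<noteq> 0" by (metis coeff_0 zero_neq_one)
  have deg: "degree ?p \<le> d" by (intro degree_diff_le) (simp_all add: degree_monom_le)
  have roots: "{x. poly ?p x = 0} = {x. x ^ d = 1}" by (simp add: poly_monom)
  have "(\<lambda>j. w ^ j) ` {1..d} \<subseteq> {x. x ^ d = 1}"
  proof safe
    fix j
    show "(w ^ j) ^ d = 1" using w by (metis mult.commute power_mult power_one)
  qed
  moreover have "finite {x :: 'a. x ^ d = 1}" using poly_roots_finite[OF p0] roots by simp
  moreover have "card {x :: 'a. x ^ d = 1} \<le> card ((\<lambda>j. w ^ j) ` {1..d})"
    using card_poly_roots_bound[OF p0] deg unfolding roots card_image[OF inj] by simp
  ultimately have "(\<lambda>j. w ^ j) ` {1..d} = {x. x ^ d = 1}" by (metis card_seteq)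
  then have "q \<in> (\<lambda>j. w ^ j) ` {1..d}" using assms by simp
  then show ?thesis using that by auto
qed

section \<open>The quadrics vanish at the classes of D^j P_sigma\<close>

lemma root_diag_pow: "root_diag d w ^\<^sub>m j = mat_diag d (\<lambda>r. w ^ ((r + 1) * j))"
proof (induction j)
  case 0
  then show ?case by (simp add: root_diag_def mat_diag_def)
next
  case (Suc j)
  then show ?case by (simp add: root_diag_def algebra_simps power_add)
qed

text \<open>A diagonal factor on the left scales rows, and each row of the permutation matrix has at
  most one 1. The diagonal starts at \<open>w\<close>, not at 1, hence the exponent
  \<open>Suc r * j\<close> in library row \<open>r\<close>.\<close>

lemma scaled_point_entries:
  assumes "r < d" "s < d"
  shows "(root_diag d w ^\<^sub>m j * perm_matrix d \<sigma>) $$ (r, s) =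
    (if \<sigma> (Suc r) = Suc s then w ^ (Suc r * j) else 0)"
proof -
  have "(\<Sum>i = 1..d. unit_matrix d i (\<sigma> i) $$ (r, s)) =
      (\<Sum>i \<in> {1..d}. if i = Suc r then (if \<sigma> (Suc r) = Suc s then 1 else 0) else 0 :: 'a)"
    using assms by (intro sum.cong) (auto simp: unit_matrix_def)
  also have "\<dots> = (if \<sigma> (Suc r) = Suc s then 1 else 0)"
    using assms by simp
  finally show ?thesis
    unfolding root_diag_pow
    by (subst mat_diag_mult_left[of _ d d]) (use assms in \<open>auto simp: perm_matrix_def\<close>)
qed

lemma scaled_point_carrier: "root_diag d w ^\<^sub>m j * perm_matrix d \<sigma> \<in> carrier_mat d d"
  by (rule mult_carrier_mat[of _ d d]) (simp_all add: root_diag_pow perm_matrix_def)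

text \<open>With \<open>x = w ^ j\<close>, row \<open>k\<close> has the single entry
  \<open>c * x ^ Suc k\<close> off which it is zero. The row sums are therefore geometric, and
  \<open>x ^ d = 1\<close> closes the progression cyclically. Injectivity of the permutation handles
  the columns.\<close>

lemma quadrics_vanish_point:
  fixes w :: "'a :: field"
  assumes "d \<ge> 1" and w: "w ^ d = 1" and \<sigma>: "\<sigma> permutes {1..d}"
  shows "\<forall>f \<in> quadrics d. eval_coord f (c \<cdot>\<^sub>m (root_diag d w ^\<^sub>m j * perm_matrix d \<sigma>)) = 0"
proof -
  define B where "B = root_diag d w ^\<^sub>m j * perm_matrix d \<sigma>"
  have B: "B \<in> carrier_mat d d" unfolding B_def by (rule scaled_point_carrier)
  have entry: "(c \<cdot>\<^sub>m B) $$ (r, s) = (if \<sigma> (Suc r) = Suc s then c * w ^ (Suc r * j) else 0)"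
    if "r < d" "s < d" for r s
    using that B scaled_point_entries[OF that, of w j \<sigma>] by (simp flip: B_def)
  define x where "x = w ^ j"
  have xd: "x ^ d = 1" unfolding x_def using w by (metis mult.commute power_mult power_one)
  have xmod: "x ^ (n mod d) = x ^ n" for n
  proof -
    have "x ^ n = x ^ (d * (n div d) + n mod d)" by simp
    also have "\<dots> = x ^ (n mod d)" unfolding power_add power_mult xd by simp
    finally show ?thesis ..
  qed
  have row: "(\<Sum>s<d. (c \<cdot>\<^sub>m B) $$ (k mod d, s)) = c * x ^ Suc k" for k
  proof -
    let ?r = "k mod d"
    have r: "?r < d" using assms by simp
    have "\<sigma> (Suc ?r) \<in> {1..d}" using permutes_in_image[OF \<sigma>] r by simp
    then obtain s0 where s0: "\<sigma> (Suc ?r) = Suc s0" "s0 < d"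
      by (metis Suc_le_D Suc_le_eq atLeastAtMost_iff One_nat_def)
    have "(\<Sum>s<d. (c \<cdot>\<^sub>m B) $$ (?r, s)) = (\<Sum>s<d. if s = s0 then c * w ^ (Suc ?r * j) else 0)"
      using r s0 by (intro sum.cong) (auto simp: entry)
    also have "\<dots> = c * x ^ Suc ?r" using s0 by (simp add: x_def power_mult mult.commute[of _ j] del: mult_Suc mult_Suc_right)
    also have "\<dots> = c * x ^ Suc k" by (simp add: xmod)
    finally show ?thesis .
  qed
  have "a = b" if "\<sigma> (Suc a) = \<sigma> (Suc b)" for a b
    using injD[OF permutes_inj[OF \<sigma>] that] by simp
  then have col: "(c \<cdot>\<^sub>m B) $$ (r1, s) * (c \<cdot>\<^sub>m B) $$ (r2, s) = 0"
    if "r1 < d" "r2 < d" "s < d" "r1 \<noteq> r2" for r1 r2 s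
    using that by (metis entry mult_eq_0_iff)
  show ?thesis
    unfolding B_def[symmetric] quadrics_vanish_iff[OF assms(1)] row
    using col by (auto simp: entry power2_eq_square)
qed

section \<open>Every common zero is a multiple of some D^j P_sigma\<close>

lemma quadrics_vanish_imp_point:
  fixes w :: "'a :: field" and A :: "'a mat"
  assumes d: "d \<ge> 1" and w: "primitive_root_of_unity d w"
    and A: "A \<in> carrier_mat d d" "A \<noteq> 0\<^sub>m d d"
    and van: "\<forall>f \<in> quadrics d. eval_coord f A = 0"
  obtains c j \<sigma> where "c \<noteq> 0" "1 \<le> j" "j \<le> d" "\<sigma> permutes {1..d}"
    "A = c \<cdot>\<^sub>m (root_diag d w ^\<^sub>m j * perm_matrix d \<sigma>)"
proof -
  \<comment> \<open>The row sums are extended periodically to all naturals, which turns the cyclic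
    relations into a forward recurrence.\<close>
  define S where "S k = (\<Sum>j<d. A $$ (k mod d, j))" for k
  from van have rows: "\<And>i j1 j2. i < d \<Longrightarrow> j1 < d \<Longrightarrow> j2 < d \<Longrightarrow> j1 \<noteq> j2 \<Longrightarrow>
      A $$ (i, j1) = 0 \<or> A $$ (i, j2) = 0"
    and cols: "\<And>i1 i2 j. i1 < d \<Longrightarrow> i2 < d \<Longrightarrow> j < d \<Longrightarrow> i1 \<noteq> i2 \<Longrightarrow>
      A $$ (i1, j) = 0 \<or> A $$ (i2, j) = 0"
    and geom: "\<And>k. (S (Suc k))\<^sup>2 = S k * S (Suc (Suc k))"
    unfolding quadrics_vanish_iff[OF d] S_def by simp_all
  have S_entry: "S i = A $$ (i, j)" if "i < d" "j < d" "A $$ (i, j) \<noteq> 0" for i j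
  proof -
    have "S i = (\<Sum>j'<d. if j' = j then A $$ (i, j) else 0)"
      unfolding S_def using that rows[OF that(1,2)] by (intro sum.cong) auto
    then show ?thesis using that by simp
  qed
  have S_period: "S (k + d) = S k" for k by (simp add: S_def)
  have S_nz: "S k \<noteq> 0" for k
  proof
    assume k: "S k = 0"
    \<comment> \<open>If \<open>S (k + n)\<close> is zero, the relation makes the square of the next
      row sum zero.\<close>
    have zero: "S (k + n) = 0" for n
    proof (induction n)
      case (Suc n)
      then show ?case using geom[of "k + n"] by simp
    qed (simp add: k)
    have "A $$ (i, j) = 0" if "i < d" "j < d" for i j
    proof (rule ccontr)
      assume nz: "A $$ (i, j) \<noteq> 0"
      \<comment> \<open>Zeros propagate only upwards, so row \<open>i\<close> is reached at the
        later index \<open>k * d + i\<close>. The subtraction is exact since \<open>d\<close> is at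
        least 1.\<close>
      have "(k + (k * d - k + i)) mod d = (k * d + i) mod d"
        using d by (cases d) (simp_all add: algebra_simps)
      then have "S (k + (k * d - k + i)) = S i" using that by (simp add: S_def)
      then show False using zero S_entry[OF that nz] nz by simp
    qed
    then have "A = 0\<^sub>m d d" using A(1) by (intro eq_matI) auto
    then show False using A(2) by simp
  qed
  define q where "q = S 1 / S 0"
  have q0: "q \<noteq> 0" using S_nz by (simp add: q_def)
  have step: "S (Suc n) = q * S n" for n
  proof (induction n)
    case (Suc n)
    \<comment> \<open>One factor of the square is replaced by \<open>q * S n\<close> using the
      induction hypothesis; then the nonzero \<open>S n\<close> cancels.\<close>
    have "S n * S (Suc (Suc n)) = S n * (q * S (Suc n))"
      unfolding geom[of n, symmetric] power2_eq_square by (subst (1) Suc) (simp only: mult_ac)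
    then show ?case using mult_left_cancel[OF S_nz[of n]] by blast
  qed (use S_nz[of 0] in \<open>simp add: q_def\<close>)
  have S_pow: "S n = S 0 * q ^ n" for n
    by (induction n) (simp_all add: step)
  \<comment> \<open>Going once around the cycle returns to the first row sum, which makes the ratio
    a root of unity.\<close>
  have "S 0 * q ^ d = S 0" using S_period[of 0] S_pow[of d] by simp
  then have "q ^ d = 1" using S_nz[of 0] by simp
  then obtain j where j: "1 \<le> j" "j \<le> d" "q = w ^ j"
    using primitive_root_of_unity_powers[OF w] by metis
  have "\<exists>s<d. A $$ (i, s) \<noteq> 0" if "i < d" for i
    using S_nz[of i] that by (auto simp: S_def intro: ccontr)
  then obtain f where f: "\<And>i. i < d \<Longrightarrow> f i < d" "\<And>i. i < d \<Longrightarrow> A $$ (i, f i) \<noteq> 0" by metis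
  \<comment> \<open>The column choice \<open>f\<close> is 0-based, hence the shifts; outside the
    range the identity is taken, as \<open>permutes\<close> demands.\<close>
  define \<sigma> where "\<sigma> i = (if i \<in> {1..d} then Suc (f (i - 1)) else i)" for i
  \<comment> \<open>Two rows with the same chosen column would violate a column quadric.\<close>
  have "inj_on \<sigma> {1..d}"
  proof (rule inj_onI)
    fix a b assume ab: "a \<in> {1..d}" "b \<in> {1..d}" "\<sigma> a = \<sigma> b"
    then have lt: "a - 1 < d" "b - 1 < d" and "f (a - 1) = f (b - 1)" by (auto simp: \<sigma>_def)
    then have "a - 1 = b - 1" using cols[OF lt f(1)[OF lt(1)]] f(2)[OF lt(1)] f(2)[OF lt(2)] by auto
    then show "a = b" using ab by auto
  qed
  moreover have "\<sigma> ` {1..d} \<subseteq> {1..d}"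
  proof safe
    fix a assume "a \<in> {1..d}"
    then show "\<sigma> a \<in> {1..d}" using f(1)[of "a - 1"] by (cases a) (auto simp: \<sigma>_def)
  qed
  ultimately have "bij_betw \<sigma> {1..d} {1..d}"
    by (simp add: bij_betw_def endo_inj_surj)
  then have \<sigma>: "\<sigma> permutes {1..d}" by (rule bij_imp_permutes) (auto simp: \<sigma>_def)
  \<comment> \<open>Row \<open>r\<close> of the product carries \<open>q ^ Suc r\<close>, while
    \<open>S r\<close> is \<open>S 0 * q ^ r\<close>; the scalar absorbs the extra factor
    \<open>q\<close>.\<close>
  have "A = (S 0 / q) \<cdot>\<^sub>m (root_diag d w ^\<^sub>m j * perm_matrix d \<sigma>)" (is "_ = _ \<cdot>\<^sub>m ?B")
  proof (rule eq_matI)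
    have B: "?B \<in> carrier_mat d d" by (rule scaled_point_carrier)
    show "dim_row A = dim_row ((S 0 / q) \<cdot>\<^sub>m ?B)" "dim_col A = dim_col ((S 0 / q) \<cdot>\<^sub>m ?B)"
      using A(1) B by (metis carrier_matD smult_carrier_mat)+
    fix r s assume "r < dim_row ((S 0 / q) \<cdot>\<^sub>m ?B)" "s < dim_col ((S 0 / q) \<cdot>\<^sub>m ?B)"
    then have rs: "r < d" "s < d" using B by (metis carrier_matD smult_carrier_mat)+
    have "((S 0 / q) \<cdot>\<^sub>m ?B) $$ (r, s) = (S 0 / q) * ?B $$ (r, s)"
      using rs B by (metis carrier_matD index_smult_mat(1))
    also have "\<dots> = (if f r = s then (S 0 / q) * w ^ (Suc r * j) else 0)"
      using rs unfolding scaled_point_entries[OF rs] by (auto simp: \<sigma>_def)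
    also have "w ^ (Suc r * j) = q ^ Suc r"
      by (simp only: j(3) mult.commute[of _ j] power_mult)
    also have "(S 0 / q) * q ^ Suc r = S r" using q0 S_pow[of r] by simp
    also have "(if f r = s then S r else 0) = A $$ (r, s)"
      using S_entry[OF rs(1) f(1)[OF rs(1)] f(2)[OF rs(1)]] rows[OF rs(1) f(1)[OF rs(1)] rs(2)]
        f(2)[OF rs(1)] by auto
    finally show "A $$ (r, s) = ((S 0 / q) \<cdot>\<^sub>m ?B) $$ (r, s)" ..
  qed
  moreover have "S 0 / q \<noteq> 0" using S_nz q0 by simp
  ultimately show ?thesis using that j \<sigma> by blast
qed

section \<open>Passage to projective classes\<close>

lemma proj_class_smult:
  assumes "c \<noteq> 0"
  shows "proj_class (c \<cdot>\<^sub>m A) = proj_class A"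
proof -
  have smult: "a \<cdot>\<^sub>m (b \<cdot>\<^sub>m A) = (a * b) \<cdot>\<^sub>m A" for a b :: 'a
    by (intro eq_matI) (auto simp: mult.assoc)
  show ?thesis
  proof (intro equalityI subsetI)
    fix X assume "X \<in> proj_class A"
    then obtain a where "a \<noteq> 0" "X = a \<cdot>\<^sub>m A" by (auto simp: proj_class_def)
    then have "X = (a / c) \<cdot>\<^sub>m (c \<cdot>\<^sub>m A)" "a / c \<noteq> 0" using assms by (simp_all add: smult)
    then show "X \<in> proj_class (c \<cdot>\<^sub>m A)" by (auto simp: proj_class_def)
  next
    fix X assume "X \<in> proj_class (c \<cdot>\<^sub>m A)"
    then obtain a where "a \<noteq> 0" "X = (a * c) \<cdot>\<^sub>m A" by (auto simp: proj_class_def smult)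
    then show "X \<in> proj_class A" using assms by (auto simp: proj_class_def)
  qed
qed

lemma mem_proj_class: "A \<in> proj_class A"
proof -
  have "A = 1 \<cdot>\<^sub>m A" by (intro eq_matI) auto
  then show ?thesis unfolding proj_class_def using zero_neq_one by fastforce
qed

lemma proj_zero_locus_quadrics:
  fixes w :: "'a :: field"
  assumes d: "d \<ge> 1" and w: "primitive_root_of_unity d w"
  shows "proj_zero_locus d (quadrics d) =
      {proj_class ((root_diag d w ^\<^sub>m j) * perm_matrix d \<sigma>) | j \<sigma>.
         1 \<le> j \<and> j \<le> d \<and> \<sigma> permutes {1..d}}" (is "_ = ?P")
proof (intro equalityI subsetI)
  fix p :: "'a mat set" assume p: "p \<in> proj_zero_locus d (quadrics d)"
  then obtain A where A: "A \<in> carrier_mat d d" "A \<noteq> 0\<^sub>m d d" "p = proj_class A"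
    by (auto simp: proj_zero_locus_def proj_space_def)
  then have "\<forall>f \<in> quadrics d. eval_coord f A = 0"
    using p mem_proj_class[of A] by (simp add: proj_zero_locus_def)
  then obtain c j \<sigma> where "c \<noteq> 0" "1 \<le> j" "j \<le> d" "\<sigma> permutes {1..d}"
    "A = c \<cdot>\<^sub>m (root_diag d w ^\<^sub>m j * perm_matrix d \<sigma>)"
    using quadrics_vanish_imp_point[OF d w A(1,2)] by metis
  then show "p \<in> ?P" using A(3) proj_class_smult[of c] by blast
next
  fix p :: "'a mat set" assume "p \<in> ?P"
  then obtain j \<sigma> where p: "p = proj_class (root_diag d w ^\<^sub>m j * perm_matrix d \<sigma>)"
    and \<sigma>: "\<sigma> permutes {1..d}" by auto
  let ?B = "root_diag d w ^\<^sub>m j * perm_matrix d \<sigma>"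
  from w have wd: "w ^ d = 1" by (simp add: primitive_root_of_unity_def)
  then have w0: "w \<noteq> 0" using d by (auto simp: power_0_left)
  \<comment> \<open>The product is nonzero because its first row contains \<open>w ^ j\<close>, in
    the column of the image of 1.\<close>
  have "\<sigma> 1 \<in> {1..d}" using permutes_in_image[OF \<sigma>] d by simp
  then have "?B $$ (0, \<sigma> 1 - 1) \<noteq> 0\<^sub>m d d $$ (0, \<sigma> 1 - 1)"
    using d w0 by (subst scaled_point_entries) auto
  then have "?B \<noteq> 0\<^sub>m d d" by metis
  then have "p \<in> proj_space d"
    unfolding p proj_space_def using scaled_point_carrier by blast
  \<comment> \<open>Vanishing is required at all representatives, which is why the previous lemma
    allows an arbitrary scalar \<open>c\<close>.\<close>
  then show "p \<in> proj_zero_locus d (quadrics d)"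
    using quadrics_vanish_point[OF d wd \<sigma>, of _ j] unfolding p proj_zero_locus_def
    by (auto simp: proj_class_def)
qed

theorem theorem8:
  fixes d :: nat and \<omega> :: "'a :: field"
  assumes "d \<ge> 1"
    and "(of_nat (fact d) :: 'a) \<noteq> 0"
    and "primitive_root_of_unity d \<omega>"
  shows "proj_zero_locus d (quadrics d) =
      {proj_class ((root_diag d \<omega> ^\<^sub>m j) * perm_matrix d \<sigma>) | j \<sigma>.
         1 \<le> j \<and> j \<le> d \<and> \<sigma> permutes {1..d}}
    \<and> proj_zero_locus d (quadric_ideal d) =
      {proj_class ((root_diag d \<omega> ^\<^sub>m j) * perm_matrix d \<sigma>) | j \<sigma>.
         1 \<le> j \<and> j \<le> d \<and> \<sigma> permutes {1..d}}"
  \<comment> \<open>Replacing the ideal by its generators reduces the second conjunct to the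
    first.\<close>
  unfolding quadric_ideal_def proj_zero_locus_genideal[OF quadrics_carrier[OF assms(1)]]
  using proj_zero_locus_quadrics[OF assms(1,3)] by (intro conjI)

end
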